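(* Let a user-to-base-station allocation and SINR requirements $\gamma_k>0$ be fixed, and let $\mathcal{H}$ be the (compact) set of strictly $\gamma_k$-feasible channels under consideration. Then the point-to-set mapping $\mathbf{H}\mapsto\mathcal{W}^\star(\mathbf{H})$, assigning to $\mathbf{H}\in\mathcal{H}$ the optimal set of beam-formers of the centralized problem, is closed and open at every $\mathbf{H}\in\mathcal{H}$.
   Context: There are $B$ base stations with $N_T$ antennas each and $K$ single-antenna users. User $k$ is served by base station $b(k)$, and $\mathcal{U}(b)=\{k: b(k)=b\}$. $\mathbf{h}_{mk}\in\mathbb{C}^{N_T}$ is the channel from base station $m$ to user $k$, $\mathbf{H}$ is the collection of all $\mathbf{h}_{mk}$, $\mathbf{w}_k\in\mathbb{C}^{N_T}$ is the beam-former for user $k$, and $\mathbf{W}=(\mathbf{w}_1,\dots,\mathbf{w}_K)$. Noise variances $\sigma_k^2>0$ are fixed. Define $$\mathrm{SINR}_k(\mathbf{W},\mathbf{H})=\frac{|\mathbf{h}_{b(k)k}^H\mathbf{w}_k|^2}{\sum_{i\in\mathcal{U}(b(k))\setminus k}|\mathbf{h}_{b(k)k}^H\mathbf{w}_i|^2+\sum_{m\ne b(k)}\sum_{i\in\mathcal{U}(m)}|\mathbf{h}_{mk}^H\mathbf{w}_i|^2+\sigma_k^2}.$$ Centralized problem: minimize $\sum_k\|\mathbf{w}_k\|^2$ subject to $\mathrm{SINR}_k(\mathbf{W},\mathbf{H})\ge\gamma_k$ for all $k$, where the phases of the beam-formers are fixed by requiring $\mathbf{h}_{b(k)k}^H\mathbf{w}_k$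 to be real and nonnegative. $\mathcal{W}^\star(\mathbf{H})$ is its set of minimizers (a singleton under this phase convention). $\mathbf{H}$ is strictly $\gamma_k$-feasible if there is $\mathbf{W}$ with $\mathrm{SINR}_k(\mathbf{W},\mathbf{H})>\gamma_k$ for all $k$. A point-to-set mapping $\mathcal{M}$ on $\mathcal{H}$ is closed at $\bar{\mathbf{H}}$ if for any sequence $\mathbf{H}_n\in\mathcal{H}$ with $\mathbf{H}_n\to\bar{\mathbf{H}}$ and any $\mathbf{W}_n\in\mathcal{M}(\mathbf{H}_n)$ with $\mathbf{W}_n\to\bar{\mathbf{W}}$, it holds that $\bar{\mathbf{W}}\in\mathcal{M}(\bar{\mathbf{H}})$. It is open at $\bar{\mathbf{H}}$ if for any sequence $\mathbf{H}_n\in\mathcal{H}$ with $\mathbf{H}_n\to\bar{\mathbf{H}}$ and any $\bar{\mathbf{W}}\in\mathcal{M}(\bar{\mathbf{H}})$ there exist $m$ and $\{\mathbf{W}_n\}$ such that $\mathbf{W}_n\in\mathcal{M}(\mathbf{H}_n)$ for all $n\ge m$ and $\mathbf{W}_n\to\bar{\mathbf{W}}$. *)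

theory Defs
  imports "HOL-Analysis.Analysis"
begin

text \<open>Base stations, users and antennas are indexed by the finite types \<open>'b\<close>, \<open>'k\<close>, \<open>'n\<close>.
  \<open>H $ m $ k\<close> is the channel from base station \<open>m\<close> to user \<open>k\<close>, and \<open>W $ k\<close> is the
  beam-former of user \<open>k\<close>; convergence of channels and of beam-formers is that of the norm
  topology on these vector types.\<close>

type_synonym ('b, 'k, 'n) channels = "((complex ^ 'n) ^ 'k) ^ 'b"
type_synonym ('k, 'n) beamformers = "(complex ^ 'n) ^ 'k"

text \<open>The Hermitian product \<open>h\<^sup>H w\<close>, conjugate-linear in the first argument.  The library
  inner product on \<open>complex ^ 'n\<close> is only the real part of it.\<close>

definition herm :: "complex ^ 'n \<Rightarrow> complex ^ 'n \<Rightarrow> complex" where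
  "herm h w = (\<Sum>j\<in>UNIV. cnj (h $ j) * w $ j)"

definition users :: "('k \<Rightarrow> 'b) \<Rightarrow> 'b \<Rightarrow> 'k set" where
  "users bs m = {k. bs k = m}"

definition SINR ::
  "('k::finite \<Rightarrow> 'b::finite) \<Rightarrow> ('k \<Rightarrow> real) \<Rightarrow> 'k \<Rightarrow>
   ('k, 'n::finite) beamformers \<Rightarrow> ('b, 'k, 'n) channels \<Rightarrow> real" where
  "SINR bs \<sigma> k W H =
     (cmod (herm (H $ bs k $ k) (W $ k)))\<^sup>2 /
     ((\<Sum>i\<in>users bs (bs k) - {k}. (cmod (herm (H $ bs k $ k) (W $ i)))\<^sup>2)
      + (\<Sum>m\<in>UNIV - {bs k}. \<Sum>i\<in>users bs m. (cmod (herm (H $ m $ k) (W $ i)))\<^sup>2)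
      + (\<sigma> k)\<^sup>2)"

definition total_power :: "('k::finite, 'n::finite) beamformers \<Rightarrow> real" where
  "total_power W = (\<Sum>k\<in>UNIV. (norm (W $ k))\<^sup>2)"

definition admissible ::
  "('k::finite \<Rightarrow> 'b::finite) \<Rightarrow> ('k \<Rightarrow> real) \<Rightarrow> ('k \<Rightarrow> real) \<Rightarrow>
   ('b, 'k, 'n::finite) channels \<Rightarrow> ('k, 'n) beamformers \<Rightarrow> bool" where
  "admissible bs \<sigma> \<gamma> H W \<longleftrightarrow>
     (\<forall>k. SINR bs \<sigma> k W H \<ge> \<gamma> k) \<and>
     (\<forall>k. herm (H $ bs k $ k) (W $ k) \<in> \<real> \<and> Re (herm (H $ bs k $ k) (W $ k)) \<ge> 0)"

definition optimal_beamformers ::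
  "('k::finite \<Rightarrow> 'b::finite) \<Rightarrow> ('k \<Rightarrow> real) \<Rightarrow> ('k \<Rightarrow> real) \<Rightarrow>
   ('b, 'k, 'n::finite) channels \<Rightarrow> ('k, 'n) beamformers set" where
  "optimal_beamformers bs \<sigma> \<gamma> H =
     {W. is_arg_min total_power (admissible bs \<sigma> \<gamma> H) W}"

text \<open>Strict feasibility imposes no phase convention on the beam-formers.\<close>

definition strictly_feasible ::
  "('k::finite \<Rightarrow> 'b::finite) \<Rightarrow> ('k \<Rightarrow> real) \<Rightarrow> ('k \<Rightarrow> real) \<Rightarrow>
   ('b, 'k, 'n::finite) channels \<Rightarrow> bool" where
  "strictly_feasible bs \<sigma> \<gamma> H \<longleftrightarrow> (\<exists>W. \<forall>k. SINR bs \<sigma> k W H > \<gamma> k)"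

text \<open>Sequential closedness and openness at \<open>x\<close> of a point-to-set mapping \<open>M\<close> with
  domain \<open>D\<close>; the sequence approaching \<open>x\<close> has to stay in \<open>D\<close>.\<close>

definition closed_map_at ::
  "'a::topological_space set \<Rightarrow> ('a \<Rightarrow> 'c::topological_space set) \<Rightarrow> 'a \<Rightarrow> bool" where
  "closed_map_at D M x \<longleftrightarrow>
     (\<forall>X Y y. (\<forall>n. X n \<in> D) \<and> X \<longlonglongrightarrow> x \<and> (\<forall>n. Y n \<in> M (X n)) \<and> Y \<longlonglongrightarrow> y
        \<longrightarrow> y \<in> M x)"

definition open_map_at ::
  "'a::topological_space set \<Rightarrow> ('a \<Rightarrow> 'c::topological_space set) \<Rightarrow> 'a \<Rightarrow> bool" where
  "open_map_at D M x \<longleftrightarrow>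
     (\<forall>X y. (\<forall>n. X n \<in> D) \<and> X \<longlonglongrightarrow> x \<and> y \<in> M x
        \<longrightarrow> (\<exists>m Y. (\<forall>n\<ge>m. Y n \<in> M (X n)) \<and> Y \<longlonglongrightarrow> y))"

end

theory Submission
  imports Defs
begin

text \<open>The SINR requirement of user \<open>k\<close> bounds the Euclidean norm of the vector of all interfering
  amplitudes and the noise amplitude by a multiple of the useful amplitude.  Under the phase
  convention the useful amplitude is a real linear function of the beam-formers, so the admissible
  set is a closed convex set (a second-order cone constraint), and an optimal beam-former is a
  point of it closest to the origin.  Hence the optimal set of a strictly feasible channel is a
  singleton (\<open>optimal_beamformers_nonempty\<close>, \<open>optimal_beamformers_unique\<close>), and both closedness
  and openness amount to continuity of that single point.

  The admissible set depends on the channel, so the work lies in comparing optimal values at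
  neighbouring channels.  Admissibility passes to limits because the constraints are continuous in
  channel and beam-formers together.  Conversely, let \<open>V\<close> be admissible for the limit channel
  and \<open>c > 1\<close>.  Amplifying all beams by \<open>c\<close> amplifies interference and signal alike but not the
  noise, so \<open>c V\<close> meets every SINR requirement strictly and continues to meet it for all nearby
  channels; rotating its phases, which costs no power, makes it admissible there.  Therefore the
  optimal norms near the limit channel are at most \<open>c\<close> times the norm of \<open>V\<close>
  (\<open>eventually_optimal_norm_le\<close>).  Letting \<open>c\<close> tend to \<open>1\<close> shows that limits of optimal
  beam-formers are optimal, which is closedness.  The same bound makes any sequence of optimal
  beam-formers bounded; all its limit points are optimal, hence equal to the unique optimum, so
  the sequence converges to it, which is openness.\<close>

section \<open>The SINR constraints as second-order cone constraints\<close>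

text \<open>The complex amplitude at user \<open>k\<close> of the beam meant for user \<open>i\<close>: it arrives through the
  channel of the base station that serves \<open>i\<close>.\<close>

definition gain ::
  "('k::finite \<Rightarrow> 'b::finite) \<Rightarrow> ('b, 'k, 'n::finite) channels \<Rightarrow> 'k \<Rightarrow>
   ('k, 'n) beamformers \<Rightarrow> 'k \<Rightarrow> complex" where
  "gain bs H k W i = herm (H $ bs i $ k) (W $ i)"

text \<open>The square root of the denominator of the SINR.  Writing it as one Euclidean norm, with the
  noise amplitude in the coordinate of the useful signal, gives convexity by the triangle
  inequality.\<close>

definition disturbance ::
  "('k::finite \<Rightarrow> 'b::finite) \<Rightarrow> ('k \<Rightarrow> real) \<Rightarrow> ('b, 'k, 'n::finite) channels \<Rightarrow> 'k \<Rightarrow>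
   ('k, 'n) beamformers \<Rightarrow> real" where
  "disturbance bs \<sigma> H k W =
     L2_set (\<lambda>i. if i = k then \<bar>\<sigma> k\<bar> else cmod (gain bs H k W i)) UNIV"

lemma herm_scaleR_add: "herm h (u *\<^sub>R v + s *\<^sub>R w) = u *\<^sub>R herm h v + s *\<^sub>R herm h w"
  unfolding herm_def
  by (simp add: scaleR_sum_right sum.distrib distrib_left)

lemma herm_vector_scalar_mult: "herm h (c *s w) = c * herm h w"
  unfolding herm_def by (simp add: sum_distrib_left mult_ac)

lemma gain_scaleR_add:
  "gain bs H k (u *\<^sub>R V + s *\<^sub>R W) i = u *\<^sub>R gain bs H k V i + s *\<^sub>R gain bs H k W i"
  by (simp add: gain_def herm_scaleR_add)

lemma gain_scaleR: "gain bs H k (u *\<^sub>R V) i = u *\<^sub>R gain bs H k V i"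
  using gain_scaleR_add [of bs H k u V 0 V i] by simp

lemma disturbance_nonneg: "disturbance bs \<sigma> H k W \<ge> 0"
  by (simp add: disturbance_def)

lemma disturbance_power:
  "(disturbance bs \<sigma> H k W)\<^sup>2 = (\<Sum>i\<in>UNIV - {k}. (cmod (gain bs H k W i))\<^sup>2) + (\<sigma> k)\<^sup>2"
proof -
  let ?f = "\<lambda>i. if i = k then \<bar>\<sigma> k\<bar> else cmod (gain bs H k W i)"
  have "(disturbance bs \<sigma> H k W)\<^sup>2 = (\<Sum>i\<in>UNIV. (?f i)\<^sup>2)"
    by (simp add: disturbance_def L2_set_def sum_nonneg)
  also have "\<dots> = (?f k)\<^sup>2 + (\<Sum>i\<in>UNIV - {k}. (?f i)\<^sup>2)"
    by (rule sum.remove) auto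
  also have "(\<Sum>i\<in>UNIV - {k}. (?f i)\<^sup>2) = (\<Sum>i\<in>UNIV - {k}. (cmod (gain bs H k W i))\<^sup>2)"
    by (rule sum.cong) auto
  finally show ?thesis by simp
qed

lemma disturbance_pos:
  assumes "(\<sigma> k)\<^sup>2 > 0"
  shows "disturbance bs \<sigma> H k W > 0"
proof -
  have "(disturbance bs \<sigma> H k W)\<^sup>2 > 0"
    unfolding disturbance_power using assms by (intro add_nonneg_pos sum_nonneg) auto
  then show ?thesis
    using disturbance_nonneg [of bs \<sigma> H k W] by (simp add: order_less_le)
qed

text \<open>Interference from the own cell and from the other cells has the same form once each beam
  is paired with the station that emits it, so the two sums merge into one over all other users.\<close>

lemma SINR_eq_gain_over_disturbance:
  "SINR bs \<sigma> k W H = (cmod (gain bs H k W k))\<^sup>2 / (disturbance bs \<sigma> H k W)\<^sup>2"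
proof -
  let ?p = "\<lambda>i. (cmod (gain bs H k W i))\<^sup>2"
  have own: "(\<Sum>i\<in>users bs (bs k) - {k}. (cmod (herm (H $ bs k $ k) (W $ i)))\<^sup>2)
           = sum ?p (users bs (bs k) - {k})"
    by (rule sum.cong) (auto simp: gain_def users_def)
  have "(\<Sum>m\<in>UNIV - {bs k}. \<Sum>i\<in>users bs m. (cmod (herm (H $ m $ k) (W $ i)))\<^sup>2)
           = (\<Sum>m\<in>UNIV - {bs k}. sum ?p (users bs m))"
    by (intro sum.cong) (auto simp: gain_def users_def)
  also have "\<dots> = sum ?p (\<Union>m\<in>UNIV - {bs k}. users bs m)"
    by (rule sum.UNION_disjoint [symmetric]) (auto simp: users_def)
  finally have other: "(\<Sum>m\<in>UNIV - {bs k}. \<Sum>i\<in>users bs m. (cmod (herm (H $ m $ k) (W $ i)))\<^sup>2)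
           = sum ?p (\<Union>m\<in>UNIV - {bs k}. users bs m)" .
  have "UNIV - {k} = (users bs (bs k) - {k}) \<union> (\<Union>m\<in>UNIV - {bs k}. users bs m)"
    by (auto simp: users_def)
  then have "sum ?p (UNIV - {k})
           = sum ?p (users bs (bs k) - {k}) + sum ?p (\<Union>m\<in>UNIV - {bs k}. users bs m)"
    by (simp only:) (rule sum.union_disjoint, auto simp: users_def)
  then show ?thesis
    unfolding SINR_def own other disturbance_power by (simp add: gain_def)
qed

lemma SINR_ge_iff:
  assumes "(\<sigma> k)\<^sup>2 > 0" "\<gamma> k > 0"
  shows "SINR bs \<sigma> k W H \<ge> \<gamma> k \<longleftrightarrow>
         sqrt (\<gamma> k) * disturbance bs \<sigma> H k W \<le> cmod (gain bs H k W k)"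
proof -
  let ?D = "disturbance bs \<sigma> H k W"
  have D: "?D > 0" using assms(1) by (rule disturbance_pos)
  have "SINR bs \<sigma> k W H \<ge> \<gamma> k \<longleftrightarrow> \<gamma> k * ?D\<^sup>2 \<le> (cmod (gain bs H k W k))\<^sup>2"
    using D by (simp add: SINR_eq_gain_over_disturbance pos_le_divide_eq)
  also have "\<dots> \<longleftrightarrow> (sqrt (\<gamma> k) * ?D)\<^sup>2 \<le> (cmod (gain bs H k W k))\<^sup>2"
    using assms(2) by (simp add: power_mult_distrib)
  also have "\<dots> \<longleftrightarrow> sqrt (\<gamma> k) * ?D \<le> cmod (gain bs H k W k)"
    using D assms(2) by (subst power_mono_iff) auto
  finally show ?thesis .
qed

text \<open>The phase convention turns the modulus on the right of \<open>SINR_ge_iff\<close> into a real part, which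
  is linear in the beam-formers.  Nonnegativity of that real part is implied by the cone
  inequality.\<close>

lemma admissible_iff_cone:
  assumes "\<And>k. (\<sigma> k)\<^sup>2 > 0" "\<And>k. \<gamma> k > 0"
  shows "admissible bs \<sigma> \<gamma> H W \<longleftrightarrow>
         (\<forall>k. Im (gain bs H k W k) = 0 \<and>
              sqrt (\<gamma> k) * disturbance bs \<sigma> H k W \<le> Re (gain bs H k W k))"
    (is "_ \<longleftrightarrow> (\<forall>k. ?cone k)")
proof -
  have "(SINR bs \<sigma> k W H \<ge> \<gamma> k \<and> gain bs H k W k \<in> \<real> \<and> Re (gain bs H k W k) \<ge> 0) \<longleftrightarrow> ?cone k"
    for k
  proof -
    have "sqrt (\<gamma> k) * disturbance bs \<sigma> H k W \<ge> 0"
      using assms(2) [of k] disturbance_nonneg [of bs \<sigma> H k W] by simp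
    moreover have "cmod z = Re z" if "Im z = 0" "Re z \<ge> 0" for z
      using that by (simp add: cmod_def)
    ultimately show ?thesis
      unfolding SINR_ge_iff [of \<sigma> k \<gamma>, OF assms] complex_is_Real_iff
      by (metis order_trans)
  qed
  then show ?thesis unfolding admissible_def gain_def [of bs H _ W, symmetric] by blast
qed

section \<open>Uniqueness and existence of the optimal beam-formers\<close>

text \<open>The disturbance is the norm of an affine function of the beam-formers; the noise coordinate is
  its constant part, and it is here that the weights have to sum to one.\<close>

lemma disturbance_convex:
  assumes "u \<ge> 0" "s \<ge> 0" "u + s = 1"
  shows "disturbance bs \<sigma> H k (u *\<^sub>R V + s *\<^sub>R W)
         \<le> u * disturbance bs \<sigma> H k V + s * disturbance bs \<sigma> H k W"
proof -
  let ?f = "\<lambda>W i. if i = k then \<bar>\<sigma> k\<bar> else cmod (gain bs H k W i)"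
  have "?f (u *\<^sub>R V + s *\<^sub>R W) i \<le> u * ?f V i + s * ?f W i" for i
  proof (cases "i = k")
    case True
    then show ?thesis using assms by (simp add: distrib_right [symmetric])
  next
    case False
    have "cmod (u *\<^sub>R gain bs H k V i + s *\<^sub>R gain bs H k W i)
        \<le> u * cmod (gain bs H k V i) + s * cmod (gain bs H k W i)"
      using norm_triangle_ineq [of "u *\<^sub>R gain bs H k V i" "s *\<^sub>R gain bs H k W i"] assms by simp
    then show ?thesis using False by (simp add: gain_scaleR_add)
  qed
  then have "L2_set (?f (u *\<^sub>R V + s *\<^sub>R W)) UNIV \<le> L2_set (\<lambda>i. u * ?f V i + s * ?f W i) UNIV"
    by (intro L2_set_mono) auto
  also have "\<dots> \<le> L2_set (\<lambda>i. u * ?f V i) UNIV + L2_set (\<lambda>i. s * ?f W i) UNIV"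
    by (rule L2_set_triangle_ineq)
  also have "\<dots> = u * L2_set (?f V) UNIV + s * L2_set (?f W) UNIV"
    using assms by (simp only: L2_set_right_distrib)
  finally show ?thesis unfolding disturbance_def .
qed

lemma convex_admissible:
  assumes "\<And>k. (\<sigma> k)\<^sup>2 > 0" "\<And>k. \<gamma> k > 0"
  shows "convex {W. admissible bs \<sigma> \<gamma> H W}"
proof (rule convexI)
  fix V W and u s :: real
  assume VW: "V \<in> {W. admissible bs \<sigma> \<gamma> H W}" "W \<in> {W. admissible bs \<sigma> \<gamma> H W}"
    and us: "0 \<le> u" "0 \<le> s" "u + s = 1"
  have "sqrt (\<gamma> k) * disturbance bs \<sigma> H k (u *\<^sub>R V + s *\<^sub>R W)
        \<le> u * Re (gain bs H k V k) + s * Re (gain bs H k W k)" for k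
  proof -
    have "sqrt (\<gamma> k) * disturbance bs \<sigma> H k (u *\<^sub>R V + s *\<^sub>R W)
        \<le> sqrt (\<gamma> k) * (u * disturbance bs \<sigma> H k V + s * disturbance bs \<sigma> H k W)"
      using disturbance_convex [OF us] assms(2) [of k] by (intro mult_left_mono) auto
    also have "\<dots> = u * (sqrt (\<gamma> k) * disturbance bs \<sigma> H k V)
                   + s * (sqrt (\<gamma> k) * disturbance bs \<sigma> H k W)"
      by (simp add: algebra_simps)
    also have "\<dots> \<le> u * Re (gain bs H k V k) + s * Re (gain bs H k W k)"
      using VW us by (intro add_mono mult_left_mono) (auto simp: admissible_iff_cone [of \<sigma> \<gamma>, OF assms])
    finally show ?thesis .
  qed
  then show "u *\<^sub>R V + s *\<^sub>R W \<in> {W. admissible bs \<sigma> \<gamma> H W}"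
    using VW by (auto simp: admissible_iff_cone [of \<sigma> \<gamma>, OF assms] gain_scaleR_add)
qed

lemma tendsto_gain:
  assumes "(X \<longlongrightarrow> H) F" "(Y \<longlongrightarrow> W) F"
  shows "((\<lambda>n. gain bs (X n) k (Y n) i) \<longlongrightarrow> gain bs H k W i) F"
  unfolding gain_def herm_def by (intro tendsto_intros assms)

lemma tendsto_disturbance:
  assumes "(X \<longlongrightarrow> H) F" "(Y \<longlongrightarrow> W) F"
  shows "((\<lambda>n. disturbance bs \<sigma> (X n) k (Y n)) \<longlongrightarrow> disturbance bs \<sigma> H k W) F"
proof -
  have "((\<lambda>n. if i = k then \<bar>\<sigma> k\<bar> else cmod (gain bs (X n) k (Y n) i))
        \<longlongrightarrow> (if i = k then \<bar>\<sigma> k\<bar> else cmod (gain bs H k W i))) F" for i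
    by (cases "i = k") (auto intro!: tendsto_intros tendsto_gain assms)
  then show ?thesis
    unfolding disturbance_def L2_set_def by (intro tendsto_intros)
qed

text \<open>The channel varies along the sequence as well; a constant channel gives closedness of the
  admissible set.\<close>

lemma admissible_limit:
  assumes "\<And>k. (\<sigma> k)\<^sup>2 > 0" "\<And>k. \<gamma> k > 0"
    and lim: "X \<longlonglongrightarrow> H" "Y \<longlonglongrightarrow> W"
    and adm: "\<And>n. admissible bs \<sigma> \<gamma> (X n) (Y n)"
  shows "admissible bs \<sigma> \<gamma> H W"
  unfolding admissible_iff_cone [of \<sigma> \<gamma>, OF assms(1,2)]
proof (intro allI conjI)
  fix k
  note adm' = adm [unfolded admissible_iff_cone [of \<sigma> \<gamma>, OF assms(1,2)]]
  have "(\<lambda>n. Im (gain bs (X n) k (Y n) k)) \<longlonglongrightarrow> Im (gain bs H k W k)"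
    by (intro tendsto_intros tendsto_gain lim)
  then show "Im (gain bs H k W k) = 0"
    using adm' by (simp add: LIMSEQ_const_iff)
  have "(\<lambda>n. Re (gain bs (X n) k (Y n) k)) \<longlonglongrightarrow> Re (gain bs H k W k)"
    and "(\<lambda>n. sqrt (\<gamma> k) * disturbance bs \<sigma> (X n) k (Y n))
         \<longlonglongrightarrow> sqrt (\<gamma> k) * disturbance bs \<sigma> H k W"
    by (intro tendsto_intros tendsto_gain tendsto_disturbance lim)+
  then show "sqrt (\<gamma> k) * disturbance bs \<sigma> H k W \<le> Re (gain bs H k W k)"
    using adm' by (intro LIMSEQ_le) auto
qed

lemma closed_admissible:
  assumes "\<And>k. (\<sigma> k)\<^sup>2 > 0" "\<And>k. \<gamma> k > 0"
  shows "closed {W. admissible bs \<sigma> \<gamma> H W}"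
  unfolding closed_sequential_limits
  using admissible_limit [of \<sigma> \<gamma>, OF assms tendsto_const] by blast

lemma total_power_eq_norm: "total_power W = (norm W)\<^sup>2"
  by (simp add: total_power_def norm_vec_def L2_set_def sum_nonneg)

lemma optimal_beamformers_iff:
  "W \<in> optimal_beamformers bs \<sigma> \<gamma> H \<longleftrightarrow>
   admissible bs \<sigma> \<gamma> H W \<and> (\<forall>V. admissible bs \<sigma> \<gamma> H V \<longrightarrow> norm W \<le> norm V)"
  by (auto simp: optimal_beamformers_def is_arg_min_linorder total_power_eq_norm)

text \<open>A closed convex set in an inner product space has at most one point of least norm.\<close>

lemma optimal_beamformers_unique:
  assumes "\<And>k. (\<sigma> k)\<^sup>2 > 0" "\<And>k. \<gamma> k > 0"
    and "V \<in> optimal_beamformers bs \<sigma> \<gamma> H" "W \<in> optimal_beamformers bs \<sigma> \<gamma> H"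
  shows "V = W"
  using assms(3,4)
  by (intro any_closest_point_unique [where a = 0,
        OF convex_admissible [of \<sigma> \<gamma>, OF assms(1,2)] closed_admissible [of \<sigma> \<gamma>, OF assms(1,2)]])
     (auto simp: optimal_beamformers_iff)

text \<open>Multiplying each beam-former by its own unit scalar leaves all moduli of received amplitudes
  and the total power unchanged.  This transfers SINR bounds that ignore the phase convention,
  such as strict feasibility, to admissible beam-formers.\<close>

lemma admissible_of_phase_alignment:
  assumes "\<And>k. SINR bs \<sigma> k W H \<ge> \<gamma> k"
  obtains V where "admissible bs \<sigma> \<gamma> H V" "norm V = norm W"
proof
  \<comment> \<open>A vanishing useful amplitude has no phase, but its scalar must still have modulus one.\<close>
  define c where "c k = (let z = gain bs H k W k in if z = 0 then 1 else cnj (sgn z))" for k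
  define V where "V = (\<chi> k. c k *s W $ k)"
  have c: "cmod (c k) = 1" for k
    by (simp add: c_def Let_def norm_sgn)
  have gain_V: "gain bs H k V i = c i * gain bs H k W i" for k i
    by (simp add: gain_def V_def herm_vector_scalar_mult)
  have "gain bs H k V k = of_real (cmod (gain bs H k W k))" for k
  proof (cases "gain bs H k W k = 0")
    case False
    let ?z = "gain bs H k W k"
    have "gain bs H k V k = ?z * cnj ?z / of_real (cmod ?z)"
      using False by (simp add: gain_V c_def Let_def sgn_eq)
    also have "?z * cnj ?z = (of_real (cmod ?z))\<^sup>2"
      using complex_norm_square [of ?z] by simp
    finally show ?thesis using False by (simp add: power2_eq_square)
  qed (simp add: gain_V)
  moreover have "SINR bs \<sigma> k V H = SINR bs \<sigma> k W H" for k
    by (simp add: SINR_eq_gain_over_disturbance disturbance_power gain_V norm_mult c)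
  ultimately show "admissible bs \<sigma> \<gamma> H V"
    using assms by (simp add: admissible_def gain_def)
  have "norm (V $ k) = norm (W $ k)" for k
    by (simp add: V_def norm_vec_def norm_mult c)
  then show "norm V = norm W"
    by (simp add: norm_vec_def [of V] norm_vec_def [of W])
qed

lemma optimal_beamformers_nonempty:
  assumes "\<And>k. (\<sigma> k)\<^sup>2 > 0" "\<And>k. \<gamma> k > 0" "strictly_feasible bs \<sigma> \<gamma> H"
  shows "optimal_beamformers bs \<sigma> \<gamma> H \<noteq> {}"
proof -
  obtain W where "\<And>k. SINR bs \<sigma> k W H \<ge> \<gamma> k"
    using assms(3) unfolding strictly_feasible_def by (meson less_imp_le)
  then obtain V where "admissible bs \<sigma> \<gamma> H V"
    using admissible_of_phase_alignment by blast
  then have "{W. admissible bs \<sigma> \<gamma> H W} \<noteq> {}" by blast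
  from distance_attains_inf [OF closed_admissible [of \<sigma> \<gamma>, OF assms(1,2)] this, of 0]
  obtain U where "admissible bs \<sigma> \<gamma> H U" "\<forall>V. admissible bs \<sigma> \<gamma> H V \<longrightarrow> norm U \<le> norm V"
    by auto
  then have "U \<in> optimal_beamformers bs \<sigma> \<gamma> H" by (simp add: optimal_beamformers_iff)
  then show ?thesis by blast
qed

section \<open>Stability under perturbation of the channels\<close>

text \<open>Scaling by \<open>c > 1\<close> multiplies the useful amplitude by \<open>c\<close> but the disturbance by less than
  \<open>c\<close>, because the noise is not scaled.  The resulting strict inequality survives small changes of
  the channel.\<close>

lemma scaled_admissible_strict:
  assumes "(\<sigma> k)\<^sup>2 > 0" "\<gamma> k > 0" "c > 1"
    and "sqrt (\<gamma> k) * disturbance bs \<sigma> H k V \<le> cmod (gain bs H k V k)"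
  shows "sqrt (\<gamma> k) * disturbance bs \<sigma> H k (c *\<^sub>R V) < cmod (gain bs H k (c *\<^sub>R V) k)"
proof -
  have "1 < c\<^sup>2" using assms(3) by (simp add: one_less_power)
  then have "(\<sigma> k)\<^sup>2 < c\<^sup>2 * (\<sigma> k)\<^sup>2" using assms(1) by simp
  then have "(disturbance bs \<sigma> H k (c *\<^sub>R V))\<^sup>2 < (c * disturbance bs \<sigma> H k V)\<^sup>2"
    by (simp add: disturbance_power power_mult_distrib gain_scaleR distrib_left
        flip: sum_distrib_left)
  then have "disturbance bs \<sigma> H k (c *\<^sub>R V) < c * disturbance bs \<sigma> H k V"
    by (rule power2_less_imp_less) (use assms(3) in \<open>simp add: disturbance_nonneg\<close>)
  then have "sqrt (\<gamma> k) * disturbance bs \<sigma> H k (c *\<^sub>R V) < sqrt (\<gamma> k) * (c * disturbance bs \<sigma> H k V)"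
    using assms(2) by simp
  also have "\<dots> = c * (sqrt (\<gamma> k) * disturbance bs \<sigma> H k V)" by simp
  also have "\<dots> \<le> c * cmod (gain bs H k V k)"
    using assms(3,4) by simp
  finally show ?thesis using assms(3) by (simp add: gain_scaleR)
qed

text \<open>Upper semicontinuity of the optimal value: the amplified \<open>V\<close> is a competitor, after a
  channel-dependent phase rotation, for all channels close to \<open>H\<close>.\<close>

lemma eventually_optimal_norm_le:
  assumes pos: "\<And>k. (\<sigma> k)\<^sup>2 > 0" "\<And>k. \<gamma> k > 0"
    and X: "X \<longlonglongrightarrow> H" and V: "admissible bs \<sigma> \<gamma> H V" and "c > 1"
    and Y: "\<forall>\<^sub>F n in sequentially. Y n \<in> optimal_beamformers bs \<sigma> \<gamma> (X n)"
  shows "\<forall>\<^sub>F n in sequentially. norm (Y n) \<le> c * norm V"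
proof -
  have "\<forall>\<^sub>F n in sequentially. sqrt (\<gamma> k) * disturbance bs \<sigma> (X n) k (c *\<^sub>R V)
          \<le> cmod (gain bs (X n) k (c *\<^sub>R V) k)" for k
  proof -
    have "sqrt (\<gamma> k) * disturbance bs \<sigma> H k V \<le> cmod (gain bs H k V k)"
      using V SINR_ge_iff [of \<sigma> k \<gamma>, OF pos] unfolding admissible_def by blast
    then have "0 < cmod (gain bs H k (c *\<^sub>R V) k) - sqrt (\<gamma> k) * disturbance bs \<sigma> H k (c *\<^sub>R V)"
      using scaled_admissible_strict [of \<sigma> k \<gamma> c, OF pos \<open>c > 1\<close>] by simp
    moreover have "(\<lambda>n. cmod (gain bs (X n) k (c *\<^sub>R V) k)
            - sqrt (\<gamma> k) * disturbance bs \<sigma> (X n) k (c *\<^sub>R V))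
        \<longlonglongrightarrow> cmod (gain bs H k (c *\<^sub>R V) k) - sqrt (\<gamma> k) * disturbance bs \<sigma> H k (c *\<^sub>R V)"
      by (intro tendsto_intros tendsto_gain tendsto_disturbance X)
    ultimately have "\<forall>\<^sub>F n in sequentially. 0 < cmod (gain bs (X n) k (c *\<^sub>R V) k)
            - sqrt (\<gamma> k) * disturbance bs \<sigma> (X n) k (c *\<^sub>R V)"
      by (intro order_tendstoD(1))
    then show ?thesis by (rule eventually_mono) simp
  qed
  then have "\<forall>\<^sub>F n in sequentially. \<forall>k. sqrt (\<gamma> k) * disturbance bs \<sigma> (X n) k (c *\<^sub>R V)
          \<le> cmod (gain bs (X n) k (c *\<^sub>R V) k)"
    by (rule eventually_all_finite)
  with Y show ?thesis
  proof eventually_elim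
    case (elim n)
    then have "\<And>k. SINR bs \<sigma> k (c *\<^sub>R V) (X n) \<ge> \<gamma> k"
      using SINR_ge_iff [of \<sigma> _ \<gamma>, OF pos] by blast
    then obtain V' where "admissible bs \<sigma> \<gamma> (X n) V'" "norm V' = norm (c *\<^sub>R V)"
      using admissible_of_phase_alignment by blast
    then show ?case
      using elim(1) \<open>c > 1\<close> by (auto simp: optimal_beamformers_iff)
  qed
qed

lemma optimal_beamformers_limit:
  assumes pos: "\<And>k. (\<sigma> k)\<^sup>2 > 0" "\<And>k. \<gamma> k > 0"
    and X: "X \<longlonglongrightarrow> H" and Y: "Y \<longlonglongrightarrow> W"
    and opt: "\<And>n. Y n \<in> optimal_beamformers bs \<sigma> \<gamma> (X n)"
  shows "W \<in> optimal_beamformers bs \<sigma> \<gamma> H"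
  unfolding optimal_beamformers_iff
proof (intro conjI allI impI)
  show "admissible bs \<sigma> \<gamma> H W"
    using admissible_limit [of \<sigma> \<gamma>, OF pos X Y] opt by (simp add: optimal_beamformers_iff)
  fix V assume V: "admissible bs \<sigma> \<gamma> H V"
  have slack: "norm W \<le> c * norm V" if "c > 1" for c
    using tendsto_norm [OF Y] eventually_optimal_norm_le [of \<sigma> \<gamma>, OF pos X V that] opt
    by (intro tendsto_upperbound [where F = sequentially]) auto
  have "z * norm W \<le> norm V" if "0 < z" "z < 1" for z
    using that slack [of "1 / z"]
    by (simp add: pos_le_divide_eq mult.commute)
  then show "norm W \<le> norm V" by (rule field_le_mult_one_interval)
qed

text \<open>A bounded sequence converges as soon as all its convergent subsequences have the same limit.
  Boundedness comes from \<open>eventually_optimal_norm_le\<close>, and the common limit from closedness and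
  uniqueness.\<close>

lemma optimal_beamformers_tendsto:
  assumes pos: "\<And>k. (\<sigma> k)\<^sup>2 > 0" "\<And>k. \<gamma> k > 0"
    and X: "X \<longlonglongrightarrow> H" and W: "W \<in> optimal_beamformers bs \<sigma> \<gamma> H"
    and opt: "\<And>n. Y n \<in> optimal_beamformers bs \<sigma> \<gamma> (X n)"
  shows "Y \<longlonglongrightarrow> W"
proof (rule ccontr)
  assume "\<not> Y \<longlonglongrightarrow> W"
  then obtain e where e: "e > 0" and "\<exists>\<^sub>F n in sequentially. dist (Y n) W \<ge> e"
    by (auto simp: tendsto_iff frequently_def not_le)
  then have "\<exists>\<^sub>\<infinity>n. dist (Y n) W \<ge> e" by (simp add: cofinite_eq_sequentially)
  then have inf: "infinite {n. dist (Y n) W \<ge> e}" by (simp add: frequently_cofinite)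
  define r where "r = enumerate {n. dist (Y n) W \<ge> e}"
  have r: "strict_mono r" "\<And>n. dist (Y (r n)) W \<ge> e"
    using inf strict_mono_enumerate enumerate_in_set [OF inf] by (auto simp: r_def)
  have "admissible bs \<sigma> \<gamma> H W" using W by (simp add: optimal_beamformers_iff)
  \<comment> \<open>Any factor above \<open>1\<close> would do here; only boundedness is wanted.\<close>
  from eventually_optimal_norm_le [of \<sigma> \<gamma>, OF pos X this, of 2 Y] opt
  have "Bseq Y" by (auto intro: BfunI)
  then have "bounded (range (Y \<circ> r))"
    unfolding Bseq_eq_bounded by (rule bounded_subset) auto
  then obtain l s where s: "strict_mono s" and l: "(Y \<circ> r \<circ> s) \<longlonglongrightarrow> l"
    using bounded_imp_convergent_subsequence by blast
  have "(X \<circ> r \<circ> s) \<longlonglongrightarrow> H"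
    using X r(1) s LIMSEQ_subseq_LIMSEQ by blast
  then have "l \<in> optimal_beamformers bs \<sigma> \<gamma> H"
    by (rule optimal_beamformers_limit [of \<sigma> \<gamma>, OF pos _ l]) (simp add: opt)
  then have "l = W" by (rule optimal_beamformers_unique [of \<sigma> \<gamma>, OF pos _ W])
  with l e have "\<forall>\<^sub>F n in sequentially. dist (Y (r (s n))) W < e"
    by (auto dest: tendstoD)
  then obtain n where "dist (Y (r (s n))) W < e"
    by (auto simp: eventually_sequentially)
  with r(2) [of "s n"] show False by simp
qed

theorem lemma3:
  fixes bs :: "'k::finite \<Rightarrow> 'b::finite"
    and \<sigma> \<gamma> :: "'k \<Rightarrow> real"
    and \<H> :: "('b, 'k, 'n::finite) channels set"
  assumes "\<And>k. (\<sigma> k)\<^sup>2 > 0"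
    and "\<And>k. \<gamma> k > 0"
    and "compact \<H>"
    and "\<And>H. H \<in> \<H> \<Longrightarrow> strictly_feasible bs \<sigma> \<gamma> H"
  shows "\<forall>H\<in>\<H>. closed_map_at \<H> (optimal_beamformers bs \<sigma> \<gamma>) H
                \<and> open_map_at \<H> (optimal_beamformers bs \<sigma> \<gamma>) H"
proof (intro ballI conjI)
  fix H assume "H \<in> \<H>"
  show "closed_map_at \<H> (optimal_beamformers bs \<sigma> \<gamma>) H"
    unfolding closed_map_at_def
  proof (intro allI impI, elim conjE)
    fix X Y W
    assume "X \<longlonglongrightarrow> H" "Y \<longlonglongrightarrow> W" "\<forall>n. Y n \<in> optimal_beamformers bs \<sigma> \<gamma> (X n)"
    then show "W \<in> optimal_beamformers bs \<sigma> \<gamma> H"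
      using optimal_beamformers_limit [of \<sigma> \<gamma> X H Y W bs, OF assms(1,2)] by simp
  qed
  show "open_map_at \<H> (optimal_beamformers bs \<sigma> \<gamma>) H"
    unfolding open_map_at_def
  proof (intro allI impI, elim conjE)
    fix X W assume "\<forall>n. X n \<in> \<H>" and X: "X \<longlonglongrightarrow> H" and W: "W \<in> optimal_beamformers bs \<sigma> \<gamma> H"
    then have "\<forall>n. \<exists>V. V \<in> optimal_beamformers bs \<sigma> \<gamma> (X n)"
      using optimal_beamformers_nonempty [of \<sigma> \<gamma>, OF assms(1,2,4)] by blast
    then obtain Y where Y: "\<And>n. Y n \<in> optimal_beamformers bs \<sigma> \<gamma> (X n)" by metis
    then have "Y \<longlonglongrightarrow> W" by (rule optimal_beamformers_tendsto [of \<sigma> \<gamma>, OF assms(1,2) X W])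
    with Y show "\<exists>m Y. (\<forall>n\<ge>m. Y n \<in> optimal_beamformers bs \<sigma> \<gamma> (X n)) \<and> Y \<longlonglongrightarrow> W"
      by blast
  qed
qed

end
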